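(* For all integers $k,l\ge 3$, $$\mathcal{C}(k,l)=\mathcal{C}(l,k)=\min\{3k+2l,\;2k+3l\}-10 .$$
   Context: $S_n$ is the set of permutations of $[n]=\{1,\dots,n\}$, with $\pi\in S_n$ written as the sequence $(\pi(1),\dots,\pi(n))$. For indices $1\le i_1<\cdots<i_k\le n$, the subsequence $S=(\pi(i_1),\dots,\pi(i_k))$, of length $k$, is a forward caged sequence if $\min(S)=\pi(i_1)$ and $\max(S)=\pi(i_k)$, and a backward caged sequence if $\max(S)=\pi(i_1)$ and $\min(S)=\pi(i_k)$. For positive integers $k,l$, $\mathcal{C}(k,l)$ denotes the smallest integer such that for every $n\ge \mathcal{C}(k,l)$, every permutation $\pi\in S_n$ admits a forward caged sequence of length $k$ or a backward caged sequence of length $l$. *)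

theory Defs
  imports "HOL-Combinatorics.Permutations"
begin

definition forward_caged :: "nat list \<Rightarrow> bool" where
  "forward_caged S \<longleftrightarrow> S \<noteq> [] \<and> Min (set S) = hd S \<and> Max (set S) = last S"

definition backward_caged :: "nat list \<Rightarrow> bool" where
  "backward_caged S \<longleftrightarrow> S \<noteq> [] \<and> Max (set S) = hd S \<and> Min (set S) = last S"

(* The list "is" holds the indices 1 <= i_1 < ... < i_k <= n of a subsequence of
   (p 1, ..., p n); the subsequence itself is map p is. *)
definition subseq_indices :: "nat \<Rightarrow> nat list \<Rightarrow> bool" where
  "subseq_indices n is \<longleftrightarrow> sorted_wrt (<) is \<and> set is \<subseteq> {1..n}"

definition has_forward_caged :: "nat \<Rightarrow> (nat \<Rightarrow> nat) \<Rightarrow> nat \<Rightarrow> bool" where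
  "has_forward_caged n p k \<longleftrightarrow>
     (\<exists>is. subseq_indices n is \<and> length is = k \<and> forward_caged (map p is))"

definition has_backward_caged :: "nat \<Rightarrow> (nat \<Rightarrow> nat) \<Rightarrow> nat \<Rightarrow> bool" where
  "has_backward_caged n p l \<longleftrightarrow>
     (\<exists>is. subseq_indices n is \<and> length is = l \<and> backward_caged (map p is))"

(* The empty permutation has no caged sequence of positive length, so for positive
   k and l the least such integer is at least 1 and natural numbers suffice. *)
definition caged_number :: "nat \<Rightarrow> nat \<Rightarrow> nat" where
  "caged_number k l =
     (LEAST N. \<forall>n\<ge>N. \<forall>p. p permutes {1..n} \<longrightarrow>
        has_forward_caged n p k \<or> has_backward_caged n p l)"

end

(* A forward (backward) caged sequence of length k >= 2 amounts to two points of the plot of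
   the permutation, one north-east (south-east) of the other, whose spanned open rectangle
   contains at least k - 2 points.

   Upper bound: suppose p(1) < p(n) (otherwise replace p by its complement) and let t, b be
   the positions of the maximum and the minimum.  The four rectangles joining cyclically
   neighbouring extreme points (left, top, right, bottom) cover the square, except, when t < b,
   for the intersection of the increasing left-right rectangle with the decreasing top-bottom
   rectangle.  Hence n is at most 4 + 2(k-3) + 2(l-3) + min(k-3, l-3).

   Lower bound: the extremal permutation is the pinwheel 2413 on the four extreme points, with
   a central block and four corner blocks making all these inequalities tight. *)
theory Submission
  imports Defs
begin

section \<open>Open rectangles in the plot, and the complement\<close>

text \<open>Only the positions of the interior points are recorded. With \<open>min\<close> and
  \<open>max\<close> one set serves rectangles with increasing and with decreasing corners.\<close>

definition open_box :: "(nat \<Rightarrow> nat) \<Rightarrow> nat \<Rightarrow> nat \<Rightarrow> nat set" where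
  "open_box p i j = {m. i < m \<and> m < j \<and> min (p i) (p j) < p m \<and> p m < max (p i) (p j)}"

lemma finite_open_box [simp]: "finite (open_box p i j)"
  by (rule finite_subset[of _ "{i<..<j}"]) (auto simp: open_box_def)

lemma open_box_self [simp]: "open_box p i i = {}"
  by (auto simp: open_box_def)

text \<open>The plot reflected upside down, which exchanges forward and backward caged sequences;
  points outside \<open>{1..n}\<close> stay fixed as \<open>permutes\<close> demands.\<close>

definition complement_perm :: "nat \<Rightarrow> (nat \<Rightarrow> nat) \<Rightarrow> nat \<Rightarrow> nat" where
  "complement_perm n p x = (if x \<in> {1..n} then n + 1 - p x else x)"

lemma permutes_range:
  assumes "p permutes {1..n::nat}" "1 \<le> x" "x \<le> n"
  shows "1 \<le> p x \<and> p x \<le> n"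
  using permutes_in_image[OF assms(1), of x] assms by simp

lemma permutes_complement_perm:
  assumes p: "p permutes {1..n}"
  shows "complement_perm n p permutes {1..n}"
proof (rule inj_imp_permutes)
  note r = permutes_range[OF p]
  show "inj_on (complement_perm n p) {1..n}"
  proof (rule inj_onI)
    fix x y assume xy: "x \<in> {1..n}" "y \<in> {1..n}" "complement_perm n p x = complement_perm n p y"
    then have "p x = p y"
      using r[of x] r[of y] by (auto simp: complement_perm_def)
    then show "x = y" using permutes_inj[OF p] by (auto dest: injD)
  qed
  show "complement_perm n p x \<in> {1..n}" if "x \<in> {1..n}" for x
    using that r[of x] by (auto simp: complement_perm_def)
qed (auto simp: complement_perm_def)

lemma complement_perm_less_iff:
  assumes "p permutes {1..n}" "i \<in> {1..n}" "j \<in> {1..n}"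
  shows "complement_perm n p i < complement_perm n p j \<longleftrightarrow> p j < p i"
  using assms permutes_range[OF assms(1), of i] permutes_range[OF assms(1), of j]
  by (auto simp: complement_perm_def)

lemma complement_perm_complement_perm:
  assumes "p permutes {1..n}"
  shows "complement_perm n (complement_perm n p) = p"
proof
  fix x show "complement_perm n (complement_perm n p) x = p x"
    using permutes_range[OF assms, of x] permutes_not_in[OF assms, of x]
    by (auto simp: complement_perm_def)
qed

lemma open_box_complement_perm:
  assumes "p permutes {1..n}" "i \<in> {1..n}" "j \<in> {1..n}"
  shows "open_box (complement_perm n p) i j = open_box p i j"
  using assms by (auto simp: open_box_def complement_perm_less_iff min_less_iff_disj less_max_iff_disj)

section \<open>Caged sequences as crowded rectangles\<close>

lemma forward_caged_iff_Ball:
  "forward_caged S \<longleftrightarrow> S \<noteq> [] \<and> (\<forall>x\<in>set S. hd S \<le> x \<and> x \<le> last S)"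
proof (cases "S = []")
  case False
  then show ?thesis
    unfolding forward_caged_def by (auto intro!: Min_eqI Max_eqI) (metis List.finite_set Min_le, metis List.finite_set Max_ge)
qed (simp add: forward_caged_def)

lemma backward_caged_iff_Ball:
  "backward_caged S \<longleftrightarrow> S \<noteq> [] \<and> (\<forall>x\<in>set S. last S \<le> x \<and> x \<le> hd S)"
proof (cases "S = []")
  case False
  then show ?thesis
    unfolding backward_caged_def by (auto intro!: Min_eqI Max_eqI) (metis List.finite_set Min_le, metis List.finite_set Max_ge)
qed (simp add: backward_caged_def)

lemma backward_caged_complement_perm:
  assumes p: "p permutes {1..n}" and "set is \<subseteq> {1..n}"
  shows "backward_caged (map p is) \<longleftrightarrow> forward_caged (map (complement_perm n p) is)"
proof (cases "is = []")
  case False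
  then have "hd is \<in> {1..n}" "last is \<in> {1..n}"
    using assms(2) hd_in_set last_in_set by blast+
  then show ?thesis
    using assms False complement_perm_less_iff[OF p]
    by (auto simp: forward_caged_iff_Ball backward_caged_iff_Ball hd_map last_map
        not_less[symmetric] subset_iff)
qed (simp add: forward_caged_iff_Ball backward_caged_iff_Ball)

lemma has_backward_caged_complement_perm:
  assumes "p permutes {1..n}"
  shows "has_backward_caged n p l \<longleftrightarrow> has_forward_caged n (complement_perm n p) l"
  unfolding has_backward_caged_def has_forward_caged_def
  using backward_caged_complement_perm[OF assms] by (auto simp: subseq_indices_def)

lemma has_forward_caged_complement_perm:
  assumes "p permutes {1..n}"
  shows "has_forward_caged n p k \<longleftrightarrow> has_backward_caged n (complement_perm n p) k"
  using has_backward_caged_complement_perm[OF permutes_complement_perm[OF assms]]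
  by (simp add: complement_perm_complement_perm[OF assms])

text \<open>The inner entries of a caged sequence lie strictly inside the rectangle of its two ends,
  by injectivity. Conversely any \<open>k - 2\<close> positions of the rectangle, sorted, fit
  between its corners.\<close>

lemma has_forward_caged_iff:
  assumes p: "p permutes {1..n}" and k: "2 \<le> k"
  shows "has_forward_caged n p k \<longleftrightarrow>
    (\<exists>i\<in>{1..n}. \<exists>j\<in>{1..n}. i < j \<and> p i < p j \<and> k \<le> card (open_box p i j) + 2)"
proof
  assume "has_forward_caged n p k"
  then obtain "is" where s: "sorted_wrt (<) is" "set is \<subseteq> {1..n}" and len: "length is = k"
    and cg: "forward_caged (map p is)"
    by (auto simp: has_forward_caged_def subseq_indices_def)
  obtain i js j where is_eq: "is = i # js @ [j]"
  proof -
    obtain i r where "is = i # r" using len k by (cases "is") auto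
    moreover then obtain js j where "r = js @ [j]" using len k by (cases r rule: rev_cases) auto
    ultimately show ?thesis using that by blast
  qed
  have ij: "i < j" and mid: "\<And>m. m \<in> set js \<Longrightarrow> i < m \<and> m < j"
    using s by (auto simp: is_eq sorted_wrt_append)
  have inj: "p x = p y \<longleftrightarrow> x = y" for x y
    using permutes_inj[OF p] by (auto dest: injD)
  have le: "p i \<le> p j" "\<And>m. m \<in> set js \<Longrightarrow> p i \<le> p m \<and> p m \<le> p j"
    using cg by (auto simp: forward_caged_iff_Ball is_eq)
  have lt: "p i < p j" using le(1) ij inj[of i j] by linarith
  have "set js \<subseteq> open_box p i j"
  proof
    fix m assume "m \<in> set js"
    then show "m \<in> open_box p i j"
      using mid[of m] le(2)[of m] inj[of i m] inj[of m j] lt by (auto simp: open_box_def)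
  qed
  then have "card (set js) \<le> card (open_box p i j)" by (rule card_mono[rotated]) simp
  moreover have "distinct js" using s by (auto simp: is_eq sorted_wrt_append strict_sorted_iff)
  ultimately have "k \<le> card (open_box p i j) + 2"
    using len by (simp add: is_eq distinct_card)
  then show "\<exists>i\<in>{1..n}. \<exists>j\<in>{1..n}. i < j \<and> p i < p j \<and> k \<le> card (open_box p i j) + 2"
    using s ij lt by (intro bexI[of _ i] bexI[of _ j]) (auto simp: is_eq)
next
  assume "\<exists>i\<in>{1..n}. \<exists>j\<in>{1..n}. i < j \<and> p i < p j \<and> k \<le> card (open_box p i j) + 2"
  then obtain i j where ij: "i \<in> {1..n}" "j \<in> {1..n}" "i < j" "p i < p j"
    and "k - 2 \<le> card (open_box p i j)" by auto
  then obtain M where M: "M \<subseteq> open_box p i j" "card M = k - 2" "finite M"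
    using obtain_subset_with_card_n by metis
  define "is" where "is = i # sorted_list_of_set M @ [j]"
  have "subseq_indices n is"
    unfolding subseq_indices_def is_def using ij M
    by (auto simp: sorted_wrt_append open_box_def subset_iff)
  moreover have "length is = k" using M k by (simp add: is_def)
  moreover have "forward_caged (map p is)"
    using M ij by (auto simp: forward_caged_iff_Ball is_def open_box_def subset_iff less_imp_le)
  ultimately show "has_forward_caged n p k" by (auto simp: has_forward_caged_def)
qed

lemma has_backward_caged_iff:
  assumes p: "p permutes {1..n}" and "2 \<le> l"
  shows "has_backward_caged n p l \<longleftrightarrow>
    (\<exists>i\<in>{1..n}. \<exists>j\<in>{1..n}. i < j \<and> p j < p i \<and> l \<le> card (open_box p i j) + 2)"
  unfolding has_backward_caged_complement_perm[OF p]
    has_forward_caged_iff[OF permutes_complement_perm[OF p] assms(2)]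
  using complement_perm_less_iff[OF p] open_box_complement_perm[OF p] by auto

section \<open>The upper bound\<close>

lemma caged_upper_bound_increasing:
  assumes p: "p permutes {1..n}" and kl: "3 \<le> k" "3 \<le> l"
    and nf: "\<not> has_forward_caged n p k" and nb: "\<not> has_backward_caged n p l"
    and n: "1 \<le> n" and less: "p 1 \<le> p n"
  shows "n + 10 < min (3 * k + 2 * l) (2 * k + 3 * l)"
proof -
  note r = permutes_range[OF p]
  obtain b where b: "b \<in> {1..n}" "p b = 1"
    using permutes_image[OF p] n by (metis atLeastAtMost_iff imageE order_refl)
  obtain t where t: "t \<in> {1..n}" "p t = n"
    using permutes_image[OF p] n by (metis atLeastAtMost_iff imageE order_refl)
  have inj: "p x = p y \<longleftrightarrow> x = y" for x y
    using permutes_inj[OF p] by (auto dest: injD)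
  \<comment> \<open>The inequalities are weak because extreme points may coincide; the box is then
    empty and \<open>3 \<le> k\<close> suffices.\<close>
  have F: "card (open_box p i j) + 3 \<le> k"
    if "i \<in> {1..n}" "j \<in> {1..n}" "i \<le> j" "p i \<le> p j" for i j
  proof (cases "i = j")
    case True then show ?thesis using kl by simp
  next
    case False
    then have "i < j" "p i < p j" using that inj[of i j] by auto
    then have "\<not> k \<le> card (open_box p i j) + 2"
      using nf that has_forward_caged_iff[OF p, of k] kl by auto
    then show ?thesis by simp
  qed
  have B: "card (open_box p i j) + 3 \<le> l"
    if "i \<in> {1..n}" "j \<in> {1..n}" "i \<le> j" "p j \<le> p i" for i j
  proof (cases "i = j")
    case True then show ?thesis using kl by simp
  next
    case False
    then have "i < j" "p j < p i" using that inj[of i j] by auto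
    then have "\<not> l \<le> card (open_box p i j) + 2"
      using nb that has_backward_caged_iff[OF p, of l] kl by auto
    then show ?thesis by simp
  qed
  have bt: "1 \<le> b" "b \<le> n" "1 \<le> t" "t \<le> n" using b t by auto
  have one: "1 \<le> p 1" "p 1 \<le> n" "1 \<le> p n" "p n \<le> n" using r n by auto
  have ext: "card {1, n, t, b} \<le> 4"
    by (simp add: card_insert_if)
  have box: "m \<in> open_box p 1 b \<longleftrightarrow> 1 < m \<and> m < b \<and> 1 < p m \<and> p m < p 1"
    "m \<in> open_box p t n \<longleftrightarrow> t < m \<and> m < n \<and> p n < p m \<and> p m < n"
    "m \<in> open_box p 1 t \<longleftrightarrow> 1 < m \<and> m < t \<and> p 1 < p m \<and> p m < n"
    "m \<in> open_box p b n \<longleftrightarrow> b < m \<and> m < n \<and> 1 < p m \<and> p m < p n"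
    "m \<in> open_box p 1 n \<longleftrightarrow> 1 < m \<and> m < n \<and> p 1 < p m \<and> p m < p n"
    "m \<in> open_box p t b \<longleftrightarrow> t < m \<and> m < b \<and> 1 < p m \<and> p m < n" for m
    using b(2) t(2) one less n by (simp_all add: open_box_def min_absorb1 min_absorb2 max_absorb1 max_absorb2)
  \<comment> \<open>By injectivity a position other than the four extreme ones differs from them in
    position and in value, so every comparison is strict.\<close>
  have inner: "1 < m" "m < n" "1 < p m" "p m < n" "m < t \<or> t < m" "m < b \<or> b < m"
      "p m < p 1 \<or> p 1 < p m" "p m < p n \<or> p n < p m"
    if "m \<in> {1..n}" "m \<notin> {1, n, t, b}" for m
    using that r[of m] inj[of m b] inj[of m t] inj[of m 1] inj[of m n] b t by simp_all linarith+
  show ?thesis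
  proof (cases "b \<le> t")
    case True
    have sub: "{1..n} \<subseteq> {1, n, t, b} \<union> (open_box p 1 b \<union> open_box p t n \<union>
        (open_box p 1 t \<union> open_box p b n))"
    proof
      fix m assume m: "m \<in> {1..n}"
      show "m \<in> {1, n, t, b} \<union> (open_box p 1 b \<union> open_box p t n \<union>
        (open_box p 1 t \<union> open_box p b n))"
      proof (cases "m \<in> {1, n, t, b}")
        case False
        \<comment> \<open>The four boxes can miss only points with \<open>t < m\<close> and
          \<open>m < b\<close>, impossible for \<open>b \<le> t\<close>.\<close>
        have "m < t \<or> b < m" using inner(6)[OF m False] True by linarith
        then have "m \<in> open_box p 1 b \<or> m \<in> open_box p t n \<or> m \<in> open_box p 1 t \<or> m \<in> open_box p b n"
          using inner[OF m False] less unfolding box by linarith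
        then show ?thesis by blast
      qed blast
    qed
    have "n \<le> card ({1, n, t, b} \<union> (open_box p 1 b \<union> open_box p t n \<union>
        (open_box p 1 t \<union> open_box p b n)))"
      using card_mono[OF _ sub] by simp
    also have "\<dots> \<le> card {1, n, t, b} + (card (open_box p 1 b) + card (open_box p t n) +
        (card (open_box p 1 t) + card (open_box p b n)))"
      by (meson add_mono card_Un_le le_trans order_refl)
    finally show ?thesis
      using ext B[of 1 b] B[of t n] F[of 1 t] F[of b n] b t one n by auto
  next
    case False
    \<comment> \<open>A missed point has \<open>t < m\<close>, \<open>m < b\<close> and its value
      between \<open>p 1\<close> and \<open>p n\<close>, so it lies in both crossing boxes.\<close>
    have sub: "{1..n} \<subseteq> {1, n, t, b} \<union> (open_box p 1 b \<union> open_box p t n \<union>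
        (open_box p 1 t \<union> open_box p b n)) \<union> (open_box p 1 n \<inter> open_box p t b)"
    proof
      fix m assume m: "m \<in> {1..n}"
      show "m \<in> {1, n, t, b} \<union> (open_box p 1 b \<union> open_box p t n \<union>
        (open_box p 1 t \<union> open_box p b n)) \<union> (open_box p 1 n \<inter> open_box p t b)"
      proof (cases "m \<in> {1, n, t, b}")
        case mf: False
        have "m \<in> open_box p 1 b \<or> m \<in> open_box p t n \<or> m \<in> open_box p 1 t \<or> m \<in> open_box p b n
            \<or> (m \<in> open_box p 1 n \<and> m \<in> open_box p t b)"
          using inner[OF m mf] less False unfolding box by linarith
        then show ?thesis by blast
      qed blast
    qed
    have "n \<le> card ({1, n, t, b} \<union> (open_box p 1 b \<union> open_box p t n \<union>
        (open_box p 1 t \<union> open_box p b n)) \<union> (open_box p 1 n \<inter> open_box p t b))"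
      using card_mono[OF _ sub] by simp
    also have "\<dots> \<le> card {1, n, t, b} + (card (open_box p 1 b) + card (open_box p t n) +
        (card (open_box p 1 t) + card (open_box p b n))) + card (open_box p 1 n \<inter> open_box p t b)"
      by (meson add_mono card_Un_le le_trans order_refl)
    finally have "n \<le> \<dots>" .
    \<comment> \<open>The intersection is at most \<open>k - 3\<close> through the forward box and
      at most \<open>l - 3\<close> through the backward box, whence the \<open>min\<close>.\<close>
    moreover have "card (open_box p 1 n \<inter> open_box p t b) \<le> card (open_box p 1 n)"
      "card (open_box p 1 n \<inter> open_box p t b) \<le> card (open_box p t b)"
      by (auto intro: card_mono)
    ultimately show ?thesis
      using ext B[of 1 b] B[of t n] F[of 1 t] F[of b n] F[of 1 n] B[of t b] b t one n less False
      by auto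
  qed
qed

text \<open>If \<open>p n < p 1\<close>, the complement is increasing at the ends with
  \<open>k\<close> and \<open>l\<close> exchanged, and the bound is symmetric in them.\<close>

lemma caged_upper_bound:
  assumes p: "p permutes {1..n}" and kl: "3 \<le> k" "3 \<le> l"
    and nf: "\<not> has_forward_caged n p k" and nb: "\<not> has_backward_caged n p l"
  shows "n + 10 < min (3 * k + 2 * l) (2 * k + 3 * l)"
proof (cases "n = 0")
  case True
  then show ?thesis using kl by simp
next
  case False
  show ?thesis
  proof (cases "p 1 \<le> p n")
    case True
    then show ?thesis using caged_upper_bound_increasing[OF assms] False by simp
  next
    case 2: False
    have "complement_perm n p 1 \<le> complement_perm n p n"
      using complement_perm_less_iff[OF p, of n 1] 2 \<open>n \<noteq> 0\<close> by auto
    then have "n + 10 < min (3 * l + 2 * k) (2 * l + 3 * k)"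
      using False assms
      by (intro caged_upper_bound_increasing[OF permutes_complement_perm[OF p]])
        (simp_all flip: has_backward_caged_complement_perm has_forward_caged_complement_perm)
    then show ?thesis by (simp add: min_def split: if_splits)
  qed
qed

section \<open>The extremal permutation\<close>

text \<open>With L, T, B, R the four extreme points, the blocks occur from left to right in the order
  L, E, A, T, C, B, F, D, R and from bottom to top in the order B, F, E, L, C, R, D, A, T. The
  blocks A, F and C are increasing of size a, the blocks E and D are decreasing of size b.\<close>

definition extremal_perm :: "nat \<Rightarrow> nat \<Rightarrow> nat \<Rightarrow> nat" where
  "extremal_perm a b x =
    (if x = 1 then a + b + 2
     else if 2 \<le> x \<and> x \<le> b + 1 then a + b + 3 - x
     else if b + 2 \<le> x \<and> x \<le> a + b + 1 then x + 2 * a + b + 2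
     else if x = a + b + 2 then 3 * a + 2 * b + 4
     else if x = 2 * a + b + 3 then 1
     else if 2 * a + b + 4 \<le> x \<and> x \<le> 3 * a + b + 3 then x - 2 * a - b - 2
     else if 3 * a + b + 4 \<le> x \<and> x \<le> 3 * a + 2 * b + 3 then 5 * a + 3 * b + 7 - x
     else if x = 3 * a + 2 * b + 4 then 2 * a + b + 3
     else x)"

text \<open>Splits the positions into nine linear pieces for arithmetic. Equations are additive to
  avoid truncated subtraction; the fixed points are block C.\<close>

lemma extremal_perm_cases:
  assumes "1 \<le> x" "x \<le> 3 * a + 2 * b + 4"
  obtains "x = 1" "extremal_perm a b x = a + b + 2"
  | "2 \<le> x" "x \<le> b + 1" "extremal_perm a b x + x = a + b + 3"
  | "b + 2 \<le> x" "x \<le> a + b + 1" "extremal_perm a b x = x + 2 * a + b + 2"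
  | "x = a + b + 2" "extremal_perm a b x = 3 * a + 2 * b + 4"
  | "a + b + 3 \<le> x" "x \<le> 2 * a + b + 2" "extremal_perm a b x = x"
  | "x = 2 * a + b + 3" "extremal_perm a b x = 1"
  | "2 * a + b + 4 \<le> x" "x \<le> 3 * a + b + 3" "extremal_perm a b x + 2 * a + b + 2 = x"
  | "3 * a + b + 4 \<le> x" "x \<le> 3 * a + 2 * b + 3" "extremal_perm a b x + x = 5 * a + 3 * b + 7"
  | "x = 3 * a + 2 * b + 4" "extremal_perm a b x = 2 * a + b + 3"
proof -
  consider "x = 1" | "2 \<le> x" "x \<le> b + 1" | "b + 2 \<le> x" "x \<le> a + b + 1" | "x = a + b + 2"
    | "a + b + 3 \<le> x" "x \<le> 2 * a + b + 2" | "x = 2 * a + b + 3"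
    | "2 * a + b + 4 \<le> x" "x \<le> 3 * a + b + 3" | "3 * a + b + 4 \<le> x" "x \<le> 3 * a + 2 * b + 3"
    | "x = 3 * a + 2 * b + 4"
    using assms by linarith
  then show thesis
    by cases (rule that; simp add: extremal_perm_def)+
qed

lemma permutes_extremal_perm: "extremal_perm a b permutes {1..3 * a + 2 * b + 4}"
proof (rule inj_imp_permutes)
  show "inj_on (extremal_perm a b) {1..3 * a + 2 * b + 4}"
  proof (rule inj_onI)
    fix x y assume "x \<in> {1..3 * a + 2 * b + 4}" "y \<in> {1..3 * a + 2 * b + 4}"
      and eq: "extremal_perm a b x = extremal_perm a b y"
    then have x: "1 \<le> x" "x \<le> 3 * a + 2 * b + 4" and y: "1 \<le> y" "y \<le> 3 * a + 2 * b + 4"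
      by auto
    show "x = y"
      \<comment> \<open>The nine pieces have disjoint ranges of values, and each is
        injective.\<close>
      using eq by - (rule extremal_perm_cases[OF x]; rule extremal_perm_cases[OF y]; linarith)
  qed
  show "extremal_perm a b x \<in> {1..3 * a + 2 * b + 4}" if "x \<in> {1..3 * a + 2 * b + 4}" for x
  proof -
    have x: "1 \<le> x" "x \<le> 3 * a + 2 * b + 4" using that by auto
    then show ?thesis by (rule extremal_perm_cases) auto
  qed
qed (auto simp: extremal_perm_def)

text \<open>Nothing is south-west of a point of E or north-east of a point of D, so \<open>m\<close>
  is in A, C or F. North-east of A are only A and T, south-west of F only B and F. The corners thus
  decide the block, and a box meets only one.\<close>

lemma extremal_perm_forward_box:
  assumes "1 \<le> i" "i < m" "m < j" "j \<le> 3 * a + 2 * b + 4"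
    and "extremal_perm a b i < extremal_perm a b m" "extremal_perm a b m < extremal_perm a b j"
  shows "if j \<le> a + b + 2 then m \<in> {b + 2..<b + 2 + a}
    else if 2 * a + b + 3 \<le> i then m \<in> {2 * a + b + 4..<2 * a + b + 4 + a}
    else m \<in> {a + b + 3..<a + b + 3 + a}"
proof -
  have i: "1 \<le> i" "i \<le> 3 * a + 2 * b + 4" and m: "1 \<le> m" "m \<le> 3 * a + 2 * b + 4"
    and j: "1 \<le> j" "j \<le> 3 * a + 2 * b + 4"
    using assms by auto
  have "(j \<le> a + b + 2 \<and> b + 2 \<le> m \<and> m < b + 2 + a) \<or>
    (a + b + 2 < j \<and> 2 * a + b + 3 \<le> i \<and> 2 * a + b + 4 \<le> m \<and> m < 2 * a + b + 4 + a) \<or>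
    (a + b + 2 < j \<and> i < 2 * a + b + 3 \<and> a + b + 3 \<le> m \<and> m < a + b + 3 + a)"
    using assms(2,3,5,6)
    \<comment> \<open>The pieces of \<open>m\<close> and \<open>i\<close> may already settle a case;
      \<open>j\<close> is split only otherwise.\<close>
    by - (rule extremal_perm_cases[OF m]; rule extremal_perm_cases[OF i];
        (linarith | (rule extremal_perm_cases[OF j]; linarith)))
  then show ?thesis by auto
qed

text \<open>Nothing is north-west of A or south-east of F, so \<open>m\<close> is in E, C or D.
  North-west of E are only L and E, south-east of D only D and R; the values of the corners tell the
  cases apart.\<close>

lemma extremal_perm_backward_box:
  assumes "1 \<le> i" "i < m" "m < j" "j \<le> 3 * a + 2 * b + 4"
    and "extremal_perm a b m < extremal_perm a b i" "extremal_perm a b j < extremal_perm a b m"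
  shows "if extremal_perm a b i \<le> a + b + 2 then m \<in> {2..<2 + b}
    else if 2 * a + b + 3 \<le> extremal_perm a b j then m \<in> {3 * a + b + 4..<3 * a + b + 4 + b}
    else m \<in> {a + b + 3..<a + b + 3 + a}"
proof -
  have i: "1 \<le> i" "i \<le> 3 * a + 2 * b + 4" and m: "1 \<le> m" "m \<le> 3 * a + 2 * b + 4"
    and j: "1 \<le> j" "j \<le> 3 * a + 2 * b + 4"
    using assms by auto
  have "(extremal_perm a b i \<le> a + b + 2 \<and> 2 \<le> m \<and> m < 2 + b) \<or>
    (a + b + 2 < extremal_perm a b i \<and> 2 * a + b + 3 \<le> extremal_perm a b j \<and>
      3 * a + b + 4 \<le> m \<and> m < 3 * a + b + 4 + b) \<or>
    (a + b + 2 < extremal_perm a b i \<and> extremal_perm a b j < 2 * a + b + 3 \<and>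
      a + b + 3 \<le> m \<and> m < a + b + 3 + a)"
    using assms(2,3,5,6)
    by - (rule extremal_perm_cases[OF m]; rule extremal_perm_cases[OF i];
        (linarith | (rule extremal_perm_cases[OF j]; linarith)))
  then show ?thesis by auto
qed

lemma extremal_perm_not_forward:
  "\<not> has_forward_caged (3 * a + 2 * b + 4) (extremal_perm a b) (a + 3)"
proof -
  have "card (open_box (extremal_perm a b) i j) \<le> a"
    if "1 \<le> i" "j \<le> 3 * a + 2 * b + 4" "extremal_perm a b i < extremal_perm a b j" for i j
  proof -
    have "open_box (extremal_perm a b) i j \<subseteq>
      (if j \<le> a + b + 2 then {b + 2..<b + 2 + a}
       else if 2 * a + b + 3 \<le> i then {2 * a + b + 4..<2 * a + b + 4 + a}
       else {a + b + 3..<a + b + 3 + a})" (is "_ \<subseteq> ?I")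
    proof
      fix m assume "m \<in> open_box (extremal_perm a b) i j"
      then show "m \<in> ?I"
        using extremal_perm_forward_box[of i m j a b] that
        by (simp add: open_box_def min_def max_def split: if_splits)
    qed
    then have "card (open_box (extremal_perm a b) i j) \<le> card ?I" by (rule card_mono[rotated]) simp
    also have "\<dots> \<le> a" by simp
    finally show ?thesis .
  qed
  then show ?thesis
    by (fastforce simp: has_forward_caged_iff[OF permutes_extremal_perm])
qed

text \<open>The central block C, of size \<open>a\<close>, also fills the backward box from T to B;
  hence the assumption \<open>a \<le> b\<close>.\<close>

lemma extremal_perm_not_backward:
  assumes "a \<le> b"
  shows "\<not> has_backward_caged (3 * a + 2 * b + 4) (extremal_perm a b) (b + 3)"
proof -
  have "card (open_box (extremal_perm a b) i j) \<le> b"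
    if "1 \<le> i" "j \<le> 3 * a + 2 * b + 4" "extremal_perm a b j < extremal_perm a b i" for i j
  proof -
    have "open_box (extremal_perm a b) i j \<subseteq>
      (if extremal_perm a b i \<le> a + b + 2 then {2..<2 + b}
       else if 2 * a + b + 3 \<le> extremal_perm a b j then {3 * a + b + 4..<3 * a + b + 4 + b}
       else {a + b + 3..<a + b + 3 + a})" (is "_ \<subseteq> ?I")
    proof
      fix m assume "m \<in> open_box (extremal_perm a b) i j"
      then show "m \<in> ?I"
        using extremal_perm_backward_box[of i m j a b] that
        by (simp add: open_box_def min_def max_def split: if_splits)
    qed
    then have "card (open_box (extremal_perm a b) i j) \<le> card ?I" by (rule card_mono[rotated]) simp
    also have "\<dots> \<le> b" using assms by simp
    finally show ?thesis .
  qed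
  then show ?thesis
    by (fastforce simp: has_backward_caged_iff[OF permutes_extremal_perm])
qed

section \<open>Symmetry and the exact value\<close>

lemma caged_number_commute: "caged_number k l = caged_number l k"
proof -
  \<comment> \<open>Applying the hypothesis to the complement of \<open>p\<close> exchanges the two
    alternatives. With \<open>k\<close> and \<open>l\<close> generalized, this gives both
    directions.\<close>
  have "\<forall>p. p permutes {1..n} \<longrightarrow> has_forward_caged n p l \<or> has_backward_caged n p k"
    if "\<forall>p. p permutes {1..n} \<longrightarrow> has_forward_caged n p k \<or> has_backward_caged n p l"
    for n k l
    using that permutes_complement_perm has_forward_caged_complement_perm
      has_backward_caged_complement_perm by blast
  then have "(\<forall>p. p permutes {1..n} \<longrightarrow> has_forward_caged n p k \<or> has_backward_caged n p l) \<longleftrightarrow>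
    (\<forall>p. p permutes {1..n} \<longrightarrow> has_forward_caged n p l \<or> has_backward_caged n p k)" for n
    by blast
  then show ?thesis by (simp add: caged_number_def)
qed

lemma caged_number_eq:
  assumes "3 \<le> k" "k \<le> l"
  shows "caged_number k l = 3 * k + 2 * l - 10"
  unfolding caged_number_def
proof (rule Least_equality)
  show "\<forall>n\<ge>3 * k + 2 * l - 10. \<forall>p. p permutes {1..n} \<longrightarrow>
      has_forward_caged n p k \<or> has_backward_caged n p l"
    using caged_upper_bound[of _ _ k l] assms by fastforce
next
  fix N assume N: "\<forall>n\<ge>N. \<forall>p. p permutes {1..n} \<longrightarrow>
      has_forward_caged n p k \<or> has_backward_caged n p l"
  define a where "a = k - 3"
  define b where "b = l - 3"
  have ab: "k = a + 3" "l = b + 3" "a \<le> b" using assms by (auto simp: a_def b_def)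
  \<comment> \<open>\<open>3 * a + 2 * b + 4\<close> is one less than the claimed value. Since
    \<open>N\<close> must work for all larger \<open>n\<close>, this one counterexample excludes
    every smaller \<open>N\<close>.\<close>
  have "\<not> N \<le> 3 * a + 2 * b + 4"
    using N permutes_extremal_perm[of a b] extremal_perm_not_forward[of a b]
      extremal_perm_not_backward[OF ab(3)] ab by blast
  then show "3 * k + 2 * l - 10 \<le> N" using ab by simp
qed

theorem theorem1p2:
  fixes k l :: nat
  assumes "k \<ge> 3" and "l \<ge> 3"
  shows "caged_number k l = caged_number l k \<and>
         caged_number l k = min (3 * k + 2 * l) (2 * k + 3 * l) - 10"
proof (cases "k \<le> l")
  case True
  then show ?thesis using caged_number_eq[of k l] caged_number_commute[of k l] assms by simp
next
  case False
  then show ?thesis using caged_number_eq[of l k] caged_number_commute[of k l] assms by simp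
qed

end
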